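(* Let $p$ be an odd prime and $n\ge 6$ an even integer such that $n\neq 2l_1p$ for every positive integer $l_1$ and $n\neq p^{l_2}+1$ for every positive integer $l_2$. Let $$f_{n,2}(x)=2\sum_{j\geq 0}\binom{n-1}{2j+1}(x^j-x^{j+1})+2\sum_{j\geq 0}\binom{n}{2j}x^j\in\mathbb{F}_p[x],\qquad C_n(x):=f_{n,2}(x)-2n\,x^{n/2-1}.$$ Then, with $N=n/2-1$, $C_n(x)$ (which has degree less than $N$) viewed as an element of $\mathbb{F}_p[x]/(x^N-1)$ is a coterm polynomial.
   Context: Coefficients are reduced modulo $p$; binomial coefficients $\binom{a}{b}$ are $0$ when $b>a$. For a commutative ring $R$ with identity and $N\ge1$, a polynomial $a_0+a_1x+\cdots+a_{N-1}x^{N-1}\in R[x]/(x^N-1)$ is a coterm polynomial if $a_i=a_{N-i}$ for all $1\le i\le\lfloor N/2\rfloor$. *)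

theory Defs
  imports "Berlekamp_Zassenhaus.Finite_Field" "HOL-Computational_Algebra.Polynomial"
begin

text \<open>The quotient ring \<open>R[x]/(x^N - 1)\<close> is the set \<open>UNIV // cyc_rel N\<close> of residue classes
  of polynomials modulo the ideal generated by \<open>x^N - 1\<close>.\<close>

definition cyc_rel :: "nat \<Rightarrow> ('a::comm_ring_1 poly \<times> 'a poly) set" where
  "cyc_rel N = {(f, g). (monom 1 N - 1) dvd (f - g)}"

definition cyc_class :: "nat \<Rightarrow> 'a::comm_ring_1 poly \<Rightarrow> 'a poly set" where
  "cyc_class N f = cyc_rel N `` {f}"

lemma equiv_cyc_rel: "equiv UNIV (cyc_rel N :: ('a::comm_ring_1 poly \<times> 'a poly) set)"
proof (rule equivI)
  show "sym (cyc_rel N :: ('a poly \<times> 'a poly) set)"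
  proof (rule symI)
    fix f g :: "'a poly"
    assume "(f, g) \<in> cyc_rel N"
    then have "(monom 1 N - 1) dvd - (f - g)"
      unfolding cyc_rel_def by (subst dvd_minus_iff) auto
    then show "(g, f) \<in> cyc_rel N"
      by (simp add: cyc_rel_def)
  qed
  show "trans (cyc_rel N :: ('a poly \<times> 'a poly) set)"
  proof (rule transI)
    fix f g h :: "'a poly"
    assume "(f, g) \<in> cyc_rel N" "(g, h) \<in> cyc_rel N"
    then have "(monom 1 N - 1) dvd ((f - g) + (g - h))"
      unfolding cyc_rel_def by (intro dvd_add) auto
    then show "(f, h) \<in> cyc_rel N"
      by (simp add: cyc_rel_def)
  qed
qed (auto simp: cyc_rel_def refl_on_def)

text \<open>The representative of the form \<open>a_0 + a_1 x + ... + a_(N-1) x^(N-1)\<close> of a class is unique,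
  so its coefficients are well defined.\<close>

lemma cyc_rel_reduced_unique:
  fixes f g :: "'a::comm_ring_1 poly"
  assumes "N \<ge> 1" "degree f < N" "degree g < N" "(f, g) \<in> cyc_rel N"
  shows "f = g"
proof (rule ccontr)
  assume "f \<noteq> g"
  obtain q where q: "f - g = (monom 1 N - 1) * q"
    using assms(4) by (auto simp: cyc_rel_def dvd_def)
  with \<open>f \<noteq> g\<close> have "q \<noteq> 0" by auto
  have cN: "coeff (monom 1 N - 1 :: 'a poly) N = 1"
    using assms(1) by simp
  have "degree (monom 1 N - 1 :: 'a poly) \<le> N"
    by (intro degree_diff_le) (auto simp: degree_monom_le)
  moreover have "N \<le> degree (monom 1 N - 1 :: 'a poly)"
    using cN by (intro le_degree) simp
  ultimately have dN: "degree (monom 1 N - 1 :: 'a poly) = N" by simp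
  have "coeff (f - g) (N + degree q) = lead_coeff q"
    unfolding q using coeff_mult_degree_sum[of "monom 1 N - 1 :: 'a poly" q] cN
    by (simp add: dN)
  moreover have "coeff (f - g) (N + degree q) = 0"
    using assms(2,3) by (simp add: coeff_eq_0)
  ultimately show False using \<open>q \<noteq> 0\<close> by simp
qed

definition coterm :: "nat \<Rightarrow> 'a::comm_ring_1 poly set \<Rightarrow> bool" where
  "coterm N A \<longleftrightarrow> N \<ge> 1 \<and> A \<in> UNIV // cyc_rel N \<and>
     (\<exists>a\<in>A. degree a < N \<and> (\<forall>i. 1 \<le> i \<and> i \<le> N div 2 \<longrightarrow> coeff a i = coeff a (N - i)))"

text \<open>The paper sums over all \<open>j \<ge> 0\<close>; every term with \<open>j > n\<close> vanishes because its binomial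
  coefficient does.\<close>

definition f2 :: "nat \<Rightarrow> 'a::comm_ring_1 poly" where
  "f2 n = 2 * (\<Sum>j\<le>n. of_nat ((n - 1) choose (2 * j + 1)) * (monom 1 j - monom 1 (j + 1)))
        + 2 * (\<Sum>j\<le>n. of_nat (n choose (2 * j)) * monom 1 j)"

definition C_poly :: "nat \<Rightarrow> 'a::comm_ring_1 poly" where
  "C_poly n = f2 n - 2 * of_nat n * monom 1 (n div 2 - 1)"

end

theory Submission
  imports Defs
begin

text \<open>Pascal's rule collapses \<open>f_{n,2}\<close> to \<open>2 \<Sum>\<^sub>k (n choose (2k+1)) x^k\<close>. For even \<open>n\<close> its term of
  degree \<open>N = n/2 - 1\<close> is \<open>2n x^N\<close>, which \<open>C_n\<close> removes, and \<open>k \<mapsto> N - k\<close> sends \<open>2k + 1\<close> to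
  \<open>n - (2k + 1)\<close>, so the remaining coefficients are symmetric.\<close>

lemma coeff_sum_of_nat_monom:
  "coeff (\<Sum>j\<le>n. of_nat (c j) * monom (1::'a::comm_ring_1) j) k
     = (if k \<le> n then of_nat (c k) else 0)"
proof -
  have "coeff (\<Sum>j\<le>n. of_nat (c j) * monom (1::'a) j) k
      = (\<Sum>j\<le>n. if j = k then of_nat (c j) else 0)"
    unfolding coeff_sum
    by (intro sum.cong refl) (simp add: of_nat_poly)
  then show ?thesis by simp
qed

lemma coeff_f2:
  assumes "n \<ge> 1"
  shows "coeff (f2 n :: 'a::comm_ring_1 poly) k = 2 * of_nat (n choose (2 * k + 1))"
proof -
  define S T :: "'a poly"
    where "S = (\<Sum>j\<le>n. of_nat ((n - 1) choose (2 * j + 1)) * monom 1 j)"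
      and "T = (\<Sum>j\<le>n. of_nat (n choose (2 * j)) * monom 1 j)"
  have "(\<Sum>j\<le>n. of_nat ((n - 1) choose (2 * j + 1)) * (monom 1 j - monom 1 (j + 1)))
      = S - monom 1 1 * S"
    unfolding S_def sum_distrib_left sum_subtractf[symmetric]
    by (intro sum.cong refl)
      (simp add: right_diff_distrib mult.left_commute[of "monom 1 (Suc 0)"] mult_monom)
  then have f2: "f2 n = 2 * (S - monom 1 1 * S + T)"
    unfolding f2_def T_def[symmetric] by (simp only: distrib_left)
  \<comment> \<open>Cutting the sums off at \<open>n\<close> is harmless: for \<open>i > n\<close>
    the binomial coefficient is zero anyway.\<close>
  have S: "coeff S i = of_nat ((n - 1) choose (2 * i + 1))" for i
    unfolding S_def coeff_sum_of_nat_monom by (simp add: binomial_eq_0)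
  have T: "coeff T i = of_nat (n choose (2 * i))" for i
    unfolding T_def coeff_sum_of_nat_monom by (simp add: binomial_eq_0)
  obtain m where m: "n = Suc m"
    using assms by (cases n) auto
  \<comment> \<open>For \<open>k > 0\<close>, splitting \<open>n choose (2 * k)\<close> by Pascal's
    rule cancels the shifted term \<open>(n - 1) choose (2 * k - 1)\<close>, and a second use of the
    rule merges the rest. For \<open>k = 0\<close> the shift contributes nothing.\<close>
  have "coeff (S - monom 1 1 * S + T) k = of_nat (n choose (2 * k + 1))"
    by (cases k) (simp_all add: S T m coeff_monom_mult)
  then show ?thesis
    by (simp add: f2 numeral_poly)
qed

text \<open>The exceptional case stays a difference: its vanishing relies on \<open>n\<close> being
  even and is derived in the degree bound.\<close>

lemma coeff_C_poly:
  assumes "n \<ge> 1"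
  shows "coeff (C_poly n :: 'a::comm_ring_1 poly) k
    = (if k = n div 2 - 1 then 2 * of_nat (n choose (2 * k + 1)) - 2 * of_nat n
       else 2 * of_nat (n choose (2 * k + 1)))"
  using coeff_f2[OF assms, where 'a = 'a]
  by (simp add: C_poly_def numeral_poly of_nat_poly)

lemma degree_C_poly_less:
  assumes "n \<ge> 4" and "even n"
  shows "degree (C_poly n :: 'a::comm_ring_1 poly) < n div 2 - 1"
proof -
  \<comment> \<open>\<open>m\<close> is one less than the target bound; \<open>n \<ge> 4\<close>
    keeps the subtraction from truncating.\<close>
  define m where "m = n div 2 - 2"
  then have n: "n = 2 * m + 4"
    using assms by auto
  have "coeff (C_poly n :: 'a poly) k = 0" if "k > m" for k
  proof (cases "k = m + 1")
    case True
    then have "2 * k + 1 = n - 1"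
      by (simp add: n)
    then have "n choose (2 * k + 1) = n"
      using binomial_symmetric[of 1 n] assms by simp
    then show ?thesis
      using True by (simp add: coeff_C_poly n)
  next
    case False
    then have "n < 2 * k + 1"
      using that by (simp add: n)
    then show ?thesis
      using False by (simp add: coeff_C_poly n binomial_eq_0)
  qed
  then have "degree (C_poly n :: 'a poly) \<le> m"
    by (intro degree_le) auto
  then show ?thesis
    by (simp add: n)
qed

lemma coeff_C_poly_symmetric:
  assumes "even n" and "1 \<le> i" and "i < n div 2 - 1"
  shows "coeff (C_poly n :: 'a::comm_ring_1 poly) i = coeff (C_poly n) (n div 2 - 1 - i)"
proof -
  have "n choose (2 * i + 1) = n choose (n - (2 * i + 1))"
    using assms by (intro binomial_symmetric) auto
  also have "n - (2 * i + 1) = 2 * (n div 2 - 1 - i) + 1"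
    using assms by auto
  finally have sym: "n choose (2 * i + 1) = n choose (2 * (n div 2 - 1 - i) + 1)" .
  \<comment> \<open>Both indices avoid the one position where \<open>C_poly n\<close> and
    \<open>f2 n\<close> differ; \<open>1 \<le> i\<close> is what keeps the reflected index away from
    it.\<close>
  have "n \<ge> 1" "i \<noteq> n div 2 - 1" "n div 2 - 1 - i \<noteq> n div 2 - 1"
    using assms by auto
  then show ?thesis
    unfolding sym coeff_C_poly[OF \<open>n \<ge> 1\<close>] by simp
qed

text \<open>A polynomial of degree below \<open>N\<close> is the reduced representative of its own
  class, so it is itself the witness in \<open>coterm\<close>.\<close>

lemma cotermI:
  fixes f :: "'a::comm_ring_1 poly"
  assumes "degree f < N"
    and "\<And>i. 1 \<le> i \<Longrightarrow> i \<le> N div 2 \<Longrightarrow> coeff f i = coeff f (N - i)"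
  shows "coterm N (cyc_class N f)"
proof -
  have "cyc_class N f \<in> UNIV // cyc_rel N"
    unfolding cyc_class_def by (intro quotientI) simp
  moreover have "f \<in> cyc_class N f"
    by (simp add: cyc_class_def cyc_rel_def)
  ultimately show ?thesis
    unfolding coterm_def using assms by auto
qed

theorem theorem5p9:
  fixes p n N :: nat
  assumes "CARD('p::prime_card) = p" and "prime p" and "odd p"
    and "n \<ge> 6" and "even n"
    and "\<And>l1::nat. l1 > 0 \<Longrightarrow> n \<noteq> 2 * l1 * p"
    and "\<And>l2::nat. l2 > 0 \<Longrightarrow> n \<noteq> p ^ l2 + 1"
    and "N = n div 2 - 1"
  shows "degree (C_poly n :: 'p mod_ring poly) < N
       \<and> coterm N (cyc_class N (C_poly n :: 'p mod_ring poly))"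
proof
  show deg: "degree (C_poly n :: 'p mod_ring poly) < N"
    using degree_C_poly_less[of n] assms by simp
  show "coterm N (cyc_class N (C_poly n :: 'p mod_ring poly))"
  proof (rule cotermI[OF deg])
    fix i assume "1 \<le> i" "i \<le> N div 2"
    then have "i < N" by simp
    with \<open>1 \<le> i\<close> show "coeff (C_poly n :: 'p mod_ring poly) i = coeff (C_poly n) (N - i)"
      using coeff_C_poly_symmetric[of n i] assms by auto
  qed
qed

end
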